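(* For every $n\ge 1$, $P_{\mathrm{HTSASM}}=P_{\mathrm{ASM}}\cap P_{\mathrm{HTS}}$.
   Context: $[n]=\{1,\dots,n\}$. An $n\times n$ alternating sign matrix (ASM) is an $n\times n$ matrix with entries in $\{0,1,-1\}$ such that in each row and each column the non-zero entries alternate in sign and the first and last non-zero entries are $1$ (so every row and column sums to $1$). $P_{\mathrm{ASM}}\subseteq\mathbb R^{n\times n}$ is the convex hull of all $n\times n$ ASMs. $P_{\mathrm{HTS}}=\{X\in\mathbb R^{n\times n}: x_{i,j}=x_{n+1-i,n+1-j}\ \forall i,j\in[n]\}$. An HTSASM (half-turn symmetric ASM) is an $n\times n$ ASM lying in $P_{\mathrm{HTS}}$, and $P_{\mathrm{HTSASM}}\subseteq\mathbb R^{n\times n}$ is the convex hull of all $n\times n$ HTSASMs. *)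

theory Defs
  imports "HOL-Analysis.Analysis"
begin

text \<open>
  An \<open>n \<times> n\<close> real matrix is an element of \<open>real^'n^'n\<close>, where \<open>'n\<close> is a nonempty
  finite linearly ordered type with \<open>n = CARD('n)\<close>. Such a type is order isomorphic to
  \<open>{1, ..., n}\<close>, by the map \<open>pos\<close> below; every \<open>n \<ge> 1\<close> occurs, for example as the
  numeral type \<open>n\<close>.
\<close>

definition pos :: "'n::{finite,linorder} \<Rightarrow> nat" where
  "pos i = card {k. k \<le> i}"

definition opp :: "'n::{finite,linorder} \<Rightarrow> 'n" where
  "opp i = (THE k. pos k = CARD('n) + 1 - pos i)"

lemma strict_mono_pos: "strict_mono (pos :: 'n::{finite,linorder} \<Rightarrow> nat)"
proof (intro strict_monoI)
  fix x y :: 'n assume "x < y"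
  then have "y \<in> {k. k \<le> y} - {k. k \<le> x}" "{k. k \<le> x} \<subseteq> {k. k \<le> y}" by auto
  then show "pos x < pos y" unfolding pos_def by (intro psubset_card_mono) auto
qed

lemma bij_betw_pos: "bij_betw (pos :: 'n::{finite,linorder} \<Rightarrow> nat) UNIV {1..CARD('n)}"
proof -
  have inj: "inj (pos :: 'n \<Rightarrow> nat)"
    using strict_mono_pos by (rule strict_mono_imp_inj_on)
  have "range (pos :: 'n \<Rightarrow> nat) \<subseteq> {1..CARD('n)}"
    unfolding pos_def by (auto simp: Suc_le_eq card_gt_0_iff intro!: card_mono)
  moreover have "card (range (pos :: 'n \<Rightarrow> nat)) = card {1..CARD('n)}"
    using inj by (simp add: card_image)
  ultimately have "range (pos :: 'n \<Rightarrow> nat) = {1..CARD('n)}"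
    by (intro card_subset_eq) auto
  with inj show ?thesis by (simp add: bij_betw_def)
qed

lemma pos_opp: "pos (opp i) = CARD('n) + 1 - pos (i :: 'n::{finite,linorder})"
proof -
  have "pos i \<in> {1..CARD('n)}"
    using bij_betw_pos by (auto simp: bij_betw_def)
  then have "CARD('n) + 1 - pos i \<in> {1..CARD('n)}" by auto
  then have "CARD('n) + 1 - pos i \<in> range (pos :: 'n \<Rightarrow> nat)"
    using bij_betw_pos[where 'n = 'n] by (simp add: bij_betw_def)
  then obtain k :: 'n where k: "pos k = CARD('n) + 1 - pos i" by (metis imageE)
  have "\<exists>!k :: 'n. pos k = CARD('n) + 1 - pos i"
    using k strict_mono_eq[OF strict_mono_pos] by metis
  from theI'[OF this] show ?thesis by (simp add: opp_def)
qed

text \<open>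
  The condition on a single row or column: its nonzero entries alternate in sign (consecutive
  nonzero entries have opposite signs), and the first and the last nonzero entry exist and are 1.
\<close>

definition alternating :: "real^'n::{finite,linorder} \<Rightarrow> bool" where
  "alternating v \<longleftrightarrow>
     (\<forall>i j. i < j \<and> v $ i \<noteq> 0 \<and> v $ j \<noteq> 0 \<and> (\<forall>k. i < k \<and> k < j \<longrightarrow> v $ k = 0)
        \<longrightarrow> sgn (v $ j) = - sgn (v $ i)) \<and>
     (\<exists>i. v $ i = 1 \<and> (\<forall>k<i. v $ k = 0)) \<and>
     (\<exists>i. v $ i = 1 \<and> (\<forall>k>i. v $ k = 0))"

definition is_ASM :: "real^'n::{finite,linorder}^'n::{finite,linorder} \<Rightarrow> bool" where
  "is_ASM X \<longleftrightarrow>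
     (\<forall>i j. X $ i $ j \<in> {0, 1, -1}) \<and>
     (\<forall>i. alternating (row i X)) \<and>
     (\<forall>j. alternating (column j X))"

definition P_ASM :: "(real^'n::{finite,linorder}^'n::{finite,linorder}) set" where
  "P_ASM = convex hull {X. is_ASM X}"

definition P_HTS :: "(real^'n::{finite,linorder}^'n::{finite,linorder}) set" where
  "P_HTS = {X. \<forall>i j. X $ i $ j = X $ opp i $ opp j}"

definition P_HTSASM :: "(real^'n::{finite,linorder}^'n::{finite,linorder}) set" where
  "P_HTSASM = convex hull {X. is_ASM X \<and> X \<in> P_HTS}"

end

theory Submission
  imports Defs
begin

text \<open>
  Pass from \<open>X\<close> to its corner sums \<open>h i j\<close>. Membership in \<open>P_ASM\<close> amounts to integer bounds on
  differences of two corner sums (horizontal and vertical steps lie in \<open>[0, 1]\<close>) together with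
  integer boundary values, and half-turn symmetry becomes \<open>h (n - i) (n - j) = h i j + n - i - j\<close>,
  again a condition on a difference. All these conditions survive the simultaneous rounding
  \<open>h \<mapsto> \<lfloor>h + u\<rfloor>\<close> with \<open>0 \<le> u < 1\<close>, so each rounding is the corner sum matrix of a half-turn
  symmetric ASM. The average of \<open>\<lfloor>h + k / N\<rfloor>\<close> over \<open>k < N\<close> is \<open>\<lfloor>N h\<rfloor> / N\<close> by Hermite's identity
  and tends to \<open>h\<close>; as the convex hull of a finite set is closed, \<open>X\<close> lies in \<open>P_HTSASM\<close>.
\<close>

subsection \<open>Positions and partial sums\<close>

type_synonym 'n sqmat = "((real, 'n) vec, 'n) vec"

lemma pos_ge_1: "1 \<le> pos (i :: 'n::{finite,linorder})"
  and pos_le_card: "pos i \<le> CARD('n)"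
  using bij_betw_pos[where 'n = 'n] by (auto simp: bij_betw_def)

lemma pos_less_iff: "pos i < pos j \<longleftrightarrow> (i :: 'n::{finite,linorder}) < j"
  using strict_mono_pos by (rule strict_mono_less)

lemma pos_eq_iff: "pos i = pos j \<longleftrightarrow> (i :: 'n::{finite,linorder}) = j"
  using strict_mono_pos by (rule strict_mono_eq)

lemma obtain_pos:
  assumes "1 \<le> m" "m \<le> CARD('n)"
  obtains i :: "'n::{finite,linorder}" where "pos i = m"
proof -
  have "m \<in> range (pos :: 'n \<Rightarrow> nat)"
    using assms bij_betw_pos[where 'n = 'n] by (simp add: bij_betw_def)
  then show ?thesis using that by auto
qed

lemma opp_opp: "opp (opp i) = (i :: 'n::{finite,linorder})"
  using pos_ge_1[of i] pos_le_card[of i] by (simp flip: pos_eq_iff add: pos_opp)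

lemma sum_pos_le_0: "(\<Sum>b :: 'n::{finite,linorder} | pos b \<le> 0. f b) = 0"
proof -
  have "{b :: 'n. pos b \<le> 0} = {}"
    using pos_ge_1[where 'n = 'n] by (auto simp: not_le Suc_le_eq)
  then show ?thesis by (metis sum.empty)
qed

lemma sum_pos_le_card: "(\<Sum>b :: 'n::{finite,linorder} | pos b \<le> CARD('n). f b) = (\<Sum>b\<in>UNIV. f b)"
  using pos_le_card[where 'n = 'n] by (intro sum.cong) auto

lemma sum_pos_le_Suc:
  fixes b :: "'n::{finite,linorder}"
  assumes "pos b = Suc j"
  shows "(\<Sum>k | pos k \<le> Suc j. f k) = (\<Sum>k | pos k \<le> j. f k) + (f b :: real)"
proof -
  have "{k. pos k \<le> Suc j} = insert b {k. pos k \<le> j}"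
    using assms by (auto simp: le_Suc_eq simp flip: pos_eq_iff)
  then show ?thesis using assms by simp
qed

lemma sum_pos_le_pos:
  fixes b :: "'n::{finite,linorder}"
  shows "(\<Sum>k | pos k \<le> pos b. f k) = (\<Sum>k | pos k \<le> pos b - 1. f k) + (f b :: real)"
  using sum_pos_le_Suc[of b "pos b - 1" f] pos_ge_1[of b] by simp

lemma sum_pos_telescope:
  assumes "j \<le> CARD('n)"
  shows "(\<Sum>b :: 'n::{finite,linorder} | pos b \<le> j. g (pos b) - g (pos b - 1)) = g j - (g 0 :: real)"
  using assms
proof (induction j)
  case 0
  show ?case by (subst sum_pos_le_0) simp
next
  case (Suc j)
  obtain b :: 'n where "pos b = Suc j" using Suc.prems by (auto intro: obtain_pos[of "Suc j"])
  from sum_pos_le_Suc[OF this] this Suc show ?case by simp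
qed

text \<open>Reversal maps the first \<open>n - i\<close> positions bijectively onto the last
  \<open>n - i\<close>, the complement of the first \<open>i\<close>.\<close>

lemma sum_opp_pos_le:
  assumes "i \<le> CARD('n)"
  shows "(\<Sum>a :: 'n::{finite,linorder} | pos a \<le> CARD('n) - i. f (opp a)) =
         (\<Sum>a\<in>UNIV. f a) - (\<Sum>a | pos a \<le> i. (f a :: real))"
proof -
  have "(\<Sum>a :: 'n | pos a \<le> CARD('n) - i. f (opp a)) = (\<Sum>a \<in> UNIV - {a. pos a \<le> i}. f a)"
  proof (rule sum.reindex_bij_witness[of _ opp opp])
    fix a :: 'n
    assume "a \<in> UNIV - {a. pos a \<le> i}"
    then show "opp a \<in> {a. pos a \<le> CARD('n) - i}"
      using assms by (simp add: pos_opp)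
  next
    fix a :: 'n
    assume "a \<in> {a. pos a \<le> CARD('n) - i}"
    then show "opp a \<in> UNIV - {a. pos a \<le> i}"
      using assms pos_ge_1[of a] pos_le_card[of a] by (auto simp add: pos_opp)
  qed (auto simp: opp_opp)
  then show ?thesis by (simp add: sum_diff)
qed

text \<open>Indexed by \<open>nat\<close> rather than \<open>'n\<close> so that the empty sum at 0
  is included; an entry \<open>b\<close> is then the step from \<open>pos b - 1\<close> to
  \<open>pos b\<close>.\<close>

definition psum :: "real^'n::{finite,linorder} \<Rightarrow> nat \<Rightarrow> real" where
  "psum v j = (\<Sum>b | pos b \<le> j. v $ b)"

lemma psum_0: "psum v 0 = 0"
  unfolding psum_def by (rule sum_pos_le_0)

lemma psum_pos: "psum v (pos b) = psum v (pos b - 1) + v $ b"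
  unfolding psum_def by (rule sum_pos_le_pos)

lemma psum_eq:
  assumes "j \<le> k" "\<And>b. j < pos b \<Longrightarrow> pos b \<le> k \<Longrightarrow> v $ b = 0"
  shows "psum v k = psum v j"
  unfolding psum_def using assms by (intro sum.mono_neutral_right) (auto simp: not_le)

subsection \<open>Alternating vectors in terms of partial sums\<close>

text \<open>A convex condition on real vectors. For integer vectors it says exactly that the entries
  are 0, 1, -1 and alternate as in an ASM; the next lemmas show this.\<close>

definition unit_psums :: "real^'n::{finite,linorder} \<Rightarrow> bool" where
  "unit_psums v \<longleftrightarrow> (\<forall>j\<le>CARD('n). psum v j \<in> {0..1}) \<and> psum v CARD('n) = 1"

lemma convex_unit_psums: "convex {v :: real^'n::{finite,linorder}. unit_psums v}"
proof (rule convexI)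
  fix x y :: "(real, 'n) vec" and s t :: real
  assume xy: "x \<in> {v. unit_psums v}" "y \<in> {v. unit_psums v}" and st: "0 \<le> s" "0 \<le> t" "s + t = 1"
  have eq: "psum (s *\<^sub>R x + t *\<^sub>R y) j = s *\<^sub>R psum x j + t *\<^sub>R psum y j" for j
    by (simp add: psum_def sum.distrib sum_distrib_left)
  have "psum (s *\<^sub>R x + t *\<^sub>R y) j \<in> {0..1}" if "j \<le> CARD('n)" for j
    unfolding eq using xy that st
    by (intro convexD[OF convex_real_interval(5)]) (auto simp: unit_psums_def)
  moreover have "psum (s *\<^sub>R x + t *\<^sub>R y) CARD('n) = 1"
    unfolding eq using xy st by (simp add: unit_psums_def)
  ultimately show "s *\<^sub>R x + t *\<^sub>R y \<in> {v. unit_psums v}"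
    by (simp add: unit_psums_def)
qed

text \<open>The last nonzero entry met so far determines the partial sum: 1 after an entry 1, and 0
  after an entry -1 or before any nonzero entry.\<close>

lemma alternating_imp_unit_psums:
  fixes v :: "real^'n::{finite,linorder}"
  assumes v: "\<And>i. v $ i \<in> {0, 1, -1}" and alt: "alternating v"
  shows "unit_psums v"
proof -
  define last_at where "last_at j k \<longleftrightarrow> pos k \<le> j \<and> v $ k \<noteq> 0 \<and> (\<forall>l>k. pos l \<le> j \<longrightarrow> v $ l = 0)"
    for j k
  \<comment> \<open>The term \<open>(1 + v $ k) / 2\<close> turns a last nonzero entry 1 or -1 into
    the partial sum 1 or 0.\<close>
  have inv: "(\<forall>k. pos k \<le> j \<longrightarrow> v $ k = 0) \<and> psum v j = 0 \<or>
             (\<exists>k. last_at j k \<and> psum v j = (1 + v $ k) / 2)" if "j \<le> CARD('n)" for j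
    using that
  proof (induction j)
    case 0
    then show ?case using pos_ge_1[where 'n = 'n] by (metis le_zero_eq not_one_le_zero psum_0)
  next
    case (Suc j)
    obtain i :: 'n where i: "pos i = Suc j"
      using Suc.prems by (auto intro: obtain_pos[of "Suc j"])
    have le: "pos l \<le> Suc j \<longleftrightarrow> pos l \<le> j \<or> l = i" for l
      using i by (auto simp: le_Suc_eq simp flip: pos_eq_iff)
    have lt: "pos l \<le> j \<longleftrightarrow> l < i" for l
      using i by (simp flip: pos_less_iff add: less_Suc_eq_le)
    have step: "psum v (Suc j) = psum v j + v $ i"
      using psum_pos[of v i] i by simp
    have IH: "(\<forall>k. pos k \<le> j \<longrightarrow> v $ k = 0) \<and> psum v j = 0 \<or>
              (\<exists>k. last_at j k \<and> psum v j = (1 + v $ k) / 2)"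
      using Suc by simp
    show ?case
    proof (cases "v $ i = 0")
      case True
      then show ?thesis using IH step by (auto simp: le last_at_def)
    next
      case False
      then have last: "last_at (Suc j) i" using i by (auto simp: last_at_def le lt)
      from IH have "psum v (Suc j) = (1 + v $ i) / 2"
      proof (elim disjE exE conjE)
        \<comment> \<open>Here \<open>i\<close> carries the first nonzero entry, which alternation
          forces to be 1.\<close>
        assume z: "\<forall>k. pos k \<le> j \<longrightarrow> v $ k = 0" and p: "psum v j = 0"
        obtain i0 where i0: "v $ i0 = 1" "\<forall>k<i0. v $ k = 0"
          using alt unfolding alternating_def by blast
        have "\<not> i0 < i" using z i0(1) lt by force
        moreover have "\<not> i < i0" using i0(2) False by auto
        ultimately have "i0 = i" by simp
        then show ?thesis using p step i0 by simp
      next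
        \<comment> \<open>Here \<open>k\<close> and \<open>i\<close> carry consecutive nonzero
          entries, so their signs are opposite.\<close>
        fix k assume k: "last_at j k" and p: "psum v j = (1 + v $ k) / 2"
        have "k < i" "v $ k \<noteq> 0" "\<forall>l. k < l \<and> l < i \<longrightarrow> v $ l = 0"
          using k by (auto simp: last_at_def lt)
        then have "sgn (v $ i) = - sgn (v $ k)"
          using alt False unfolding alternating_def by blast
        then have "v $ i = - v $ k" using v[of i] v[of k] by auto
        then show ?thesis using p step by simp
      qed
      then show ?thesis using last by auto
    qed
  qed
  have "psum v j \<in> {0..1}" if "j \<le> CARD('n)" for j
    using inv[OF that]
  proof (elim disjE exE conjE)
    fix k assume "psum v j = (1 + v $ k) / 2"
    then show ?thesis using v[of k] by auto
  qed simp
  moreover have "psum v CARD('n) = 1"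
  proof -
    obtain m where m: "v $ m = 1" "\<forall>k>m. v $ k = 0"
      using alt unfolding alternating_def by blast
    from inv[of "CARD('n)"] obtain k
      where k: "last_at CARD('n) k" "psum v CARD('n) = (1 + v $ k) / 2"
      using m pos_le_card[of m] by auto
    have "k = m" using k(1) m by (metis last_at_def linorder_neqE pos_le_card zero_neq_one)
    then show ?thesis using k m by simp
  qed
  ultimately show ?thesis by (simp add: unit_psums_def)
qed

text \<open>Integer partial sums in [0, 1] are 0 or 1, and entries are their successive differences.
  An entry 1 moves the sum up, -1 moves it down, 0 keeps it; a path between two levels alternates
  its moves, and starting at 0 and ending at 1 makes the first and last move go up.\<close>

lemma unit_psums_imp_alternating:
  fixes v :: "real^'n::{finite,linorder}"
  assumes int: "\<And>i. v $ i \<in> \<int>" and v: "unit_psums v"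
  shows "v $ i \<in> {0, 1, -1}" "alternating v"
proof -
  have p01: "psum v j = 0 \<or> psum v j = 1" if "j \<le> CARD('n)" for j
  proof -
    have "psum v j \<in> \<int>" unfolding psum_def using int by (intro Ints_sum) auto
    then obtain z where z: "psum v j = of_int z" by (auto elim: Ints_cases)
    moreover have "psum v j \<in> {0..1}" using v that by (auto simp: unit_psums_def)
    ultimately have "0 \<le> z" "z \<le> 1" by auto
    then show ?thesis using z by (cases "z = 0") auto
  qed
  have p: "psum v (pos i) = 0 \<or> psum v (pos i) = 1"
    "psum v (pos i - 1) = 0 \<or> psum v (pos i - 1) = 1" for i :: 'n
    using pos_le_card[of i] by (auto intro!: p01)
  have val: "v $ i = psum v (pos i) - psum v (pos i - 1)" for i
    using psum_pos[of v i] by simp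
  show "v $ i \<in> {0, 1, -1}" using p[of i] val[of i] by auto
  have tot: "psum v CARD('n) = 1" using v by (simp add: unit_psums_def)
  have ex: "\<exists>i. v $ i \<noteq> 0"
  proof (rule ccontr)
    assume "\<nexists>i. v $ i \<noteq> 0"
    then have "psum v CARD('n) = 0" by (simp add: psum_def)
    then show False using tot by simp
  qed
  have "sgn (v $ j) = - sgn (v $ i)"
    if ij: "i < j" "v $ i \<noteq> 0" "v $ j \<noteq> 0" "\<forall>k. i < k \<and> k < j \<longrightarrow> v $ k = 0" for i j
  proof -
    have "pos i < pos j" using ij by (simp add: pos_less_iff)
    then have "psum v (pos j - 1) = psum v (pos i)"
      using ij(4) by (intro psum_eq) (auto simp flip: pos_less_iff)
    then show ?thesis using p[of i] p[of j] val[of i] val[of j] ij by auto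
  qed
  moreover have "\<exists>i. v $ i = 1 \<and> (\<forall>k<i. v $ k = 0)"
  proof -
    define i where "i = Min {i. v $ i \<noteq> 0}"
    have "i \<in> {i. v $ i \<noteq> 0}" unfolding i_def using ex by (intro Min_in) auto
    then have nz: "v $ i \<noteq> 0" by simp
    have z: "v $ k = 0" if "k < i" for k
      using that Min_le[of "{i. v $ i \<noteq> 0}" k] by (auto simp: i_def not_le[symmetric])
    have "psum v (pos i - 1) = psum v 0"
      using z by (intro psum_eq) (auto simp flip: pos_less_iff)
    then have "v $ i = 1" using nz p[of i] val[of i] by (auto simp: psum_0)
    with z show ?thesis by blast
  qed
  moreover have "\<exists>i. v $ i = 1 \<and> (\<forall>k>i. v $ k = 0)"
  proof -
    define i where "i = Max {i. v $ i \<noteq> 0}"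
    have "i \<in> {i. v $ i \<noteq> 0}" unfolding i_def using ex by (intro Max_in) auto
    then have nz: "v $ i \<noteq> 0" by simp
    have z: "v $ k = 0" if "i < k" for k
      using that Max_ge[of "{i. v $ i \<noteq> 0}" k] by (auto simp: i_def not_le[symmetric])
    have "psum v CARD('n) = psum v (pos i)"
      using z pos_le_card[of i] by (intro psum_eq) (auto simp flip: pos_less_iff)
    then have "v $ i = 1" using nz p[of i] val[of i] tot by auto
    with z show ?thesis by blast
  qed
  ultimately show "alternating v" unfolding alternating_def by blast
qed

text \<open>The row and column conditions hold at every ASM and define a convex set, so they pass to
  the hull.\<close>

lemma P_ASM_imp_unit_psums:
  fixes X :: "'n::{finite,linorder} sqmat"
  assumes "X \<in> P_ASM"
  shows "unit_psums (row i X)" "unit_psums (column j X)"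
proof -
  let ?S = "{X :: 'n sqmat. (\<forall>i. unit_psums (row i X)) \<and> (\<forall>j. unit_psums (column j X))}"
  have lin: "row i (s *\<^sub>R X + t *\<^sub>R Y) = s *\<^sub>R row i X + t *\<^sub>R row i Y"
    "column i (s *\<^sub>R X + t *\<^sub>R Y) = s *\<^sub>R column i X + t *\<^sub>R column i Y"
    for i s t and X Y :: "'n sqmat"
    by (auto simp: row_def column_def vec_eq_iff)
  have "convex ?S"
    by (auto intro!: convexI simp: lin convexD[OF convex_unit_psums, simplified])
  moreover have "{X :: 'n sqmat. is_ASM X} \<subseteq> ?S"
  proof clarify
    fix X :: "'n sqmat"
    assume X: "is_ASM X"
    then have "row i X $ k \<in> {0, 1, -1}" "column j X $ k \<in> {0, 1, -1}" for i j k
      unfolding is_ASM_def row_def column_def vec_lambda_beta by blast+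
    with X show "(\<forall>i. unit_psums (row i X)) \<and> (\<forall>j. unit_psums (column j X))"
      using alternating_imp_unit_psums unfolding is_ASM_def by blast
  qed
  ultimately have "P_ASM \<subseteq> ?S" unfolding P_ASM_def by (rule hull_minimal[rotated])
  then show "unit_psums (row i X)" "unit_psums (column j X)" using assms by auto
qed

subsection \<open>Corner sums\<close>

definition csum :: "'n::{finite,linorder} sqmat \<Rightarrow> nat \<Rightarrow> nat \<Rightarrow> real" where
  "csum X i j = (\<Sum>a | pos a \<le> i. \<Sum>b | pos b \<le> j. X $ a $ b)"

text \<open>The mixed second difference, which recovers a matrix from its corner sums. Since
  \<open>pos\<close> is at least 1, the subtraction on \<open>nat\<close> never truncates.\<close>

definition of_csum :: "(nat \<Rightarrow> nat \<Rightarrow> real) \<Rightarrow> 'n::{finite,linorder} sqmat" where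
  "of_csum F = (\<chi> a b. F (pos a) (pos b) - F (pos a - 1) (pos b)
     - (F (pos a) (pos b - 1) - F (pos a - 1) (pos b - 1)))"

lemma csum_0: "csum X 0 j = 0" "csum X i 0 = 0"
  unfolding csum_def by (simp_all only: sum_pos_le_0 sum.neutral_const)

text \<open>A step of the corner sums is a partial sum of a row or column, so
  \<open>unit_psums\<close> bounds exactly these steps.\<close>

lemma csum_row: "csum X (pos a) j = csum X (pos a - 1) j + psum (row a X) j"
  by (simp add: csum_def psum_def row_def sum_pos_le_pos[of _ a])

lemma csum_column: "csum X i (pos b) = csum X i (pos b - 1) + psum (column b X) i"
  by (simp add: csum_def psum_def column_def sum_pos_le_pos[of _ b] sum.distrib)

lemma of_csum_csum: "of_csum (csum X) = X"
  by (simp add: of_csum_def vec_eq_iff csum_row psum_pos row_def)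

text \<open>At full height each step to the right adds a column total, which is 1; telescoping
  counts the columns.\<close>

lemma csum_card_left:
  fixes X :: "'n::{finite,linorder} sqmat"
  assumes "\<And>b. psum (column b X) CARD('n) = 1" "j \<le> CARD('n)"
  shows "csum X CARD('n) j = real j"
proof -
  have "csum X CARD('n) j = (\<Sum>b :: 'n | pos b \<le> j. csum X CARD('n) (pos b) - csum X CARD('n) (pos b - 1))"
    using assms(2) by (subst sum_pos_telescope) (auto simp: csum_0)
  also have "\<dots> = (\<Sum>b :: 'n | pos b \<le> j. real (pos b) - real (pos b - 1))"
    using pos_ge_1[where 'n = 'n] by (intro sum.cong) (auto simp: csum_column assms of_nat_diff)
  also have "\<dots> = real j"
    using assms(2) by (subst sum_pos_telescope) auto
  finally show ?thesis .
qed

lemma csum_card_right: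
  fixes X :: "'n::{finite,linorder} sqmat"
  assumes "\<And>a. psum (row a X) CARD('n) = 1" "i \<le> CARD('n)"
  shows "csum X i CARD('n) = real i"
proof -
  have "csum X i CARD('n) = (\<Sum>a :: 'n | pos a \<le> i. csum X (pos a) CARD('n) - csum X (pos a - 1) CARD('n))"
    using assms(2) by (subst sum_pos_telescope[of i "\<lambda>m. csum X m CARD('n)"]) (auto simp: csum_0)
  also have "\<dots> = (\<Sum>a :: 'n | pos a \<le> i. real (pos a) - real (pos a - 1))"
    using pos_ge_1[where 'n = 'n] by (intro sum.cong) (auto simp: csum_row assms of_nat_diff)
  also have "\<dots> = real i"
    using assms(2) by (subst sum_pos_telescope) auto
  finally show ?thesis .
qed

text \<open>A half turn carries the leading \<open>n - i\<close> by \<open>n - j\<close> block to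
  the rows after \<open>i\<close> and columns after \<open>j\<close>. Inclusion-exclusion expresses
  the sum of that block by corner sums, three of which are known boundary values.\<close>

lemma csum_opp:
  fixes X :: "'n::{finite,linorder} sqmat"
  assumes X: "X \<in> P_HTS"
    and r: "\<And>a. psum (row a X) CARD('n) = 1" and c: "\<And>b. psum (column b X) CARD('n) = 1"
    and ij: "i \<le> CARD('n)" "j \<le> CARD('n)"
  shows "csum X (CARD('n) - i) (CARD('n) - j) = csum X i j + (real CARD('n) - real i - real j)"
proof -
  \<comment> \<open>This is the sum of row \<open>a\<close> over the columns after
    \<open>j\<close>.\<close>
  let ?f = "\<lambda>a. \<Sum>b | pos b \<le> CARD('n) - j. X $ a $ opp b"
  have f: "?f a = 1 - psum (row a X) j" for a
    using r[of a] unfolding sum_opp_pos_le[OF ij(2)] psum_def sum_pos_le_card by (simp add: row_def)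
  have part: "(\<Sum>a | pos a \<le> k. ?f a) = csum X k CARD('n) - csum X k j" for k
    unfolding f
    by (simp add: sum_subtractf csum_def psum_def row_def r[unfolded psum_def row_def, simplified])
  have "csum X (CARD('n) - i) (CARD('n) - j) = (\<Sum>a | pos a \<le> CARD('n) - i. ?f (opp a))"
    unfolding csum_def using X by (intro sum.cong) (auto simp: P_HTS_def)
  also have "\<dots> = (\<Sum>a\<in>UNIV. ?f a) - (\<Sum>a | pos a \<le> i. ?f a)"
    using ij(1) by (rule sum_opp_pos_le)
  also have "\<dots> = (\<Sum>a | pos a \<le> CARD('n). ?f a) - (\<Sum>a | pos a \<le> i. ?f a)"
    unfolding sum_pos_le_card ..
  finally have "csum X (CARD('n) - i) (CARD('n) - j) =
      csum X CARD('n) CARD('n) - csum X CARD('n) j - (csum X i CARD('n) - csum X i j)"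
    by (simp only: part)
  then show ?thesis
    using ij by (simp add: csum_card_left[OF c] csum_card_right[OF r])
qed

lemma psum_row_of_csum:
  fixes a :: "'n::{finite,linorder}"
  assumes "\<And>i. F i 0 = 0" "j \<le> CARD('n)"
  shows "psum (row a (of_csum F :: 'n::{finite,linorder} sqmat)) j = F (pos a) j - F (pos a - 1) j"
  using sum_pos_telescope[OF assms(2), of "\<lambda>m. F (pos a) m - F (pos a - 1) m"]
  by (simp add: psum_def row_def of_csum_def assms(1) algebra_simps)

lemma psum_column_of_csum:
  fixes b :: "'n::{finite,linorder}"
  assumes "\<And>j. F 0 j = 0" "i \<le> CARD('n)"
  shows "psum (column b (of_csum F :: 'n::{finite,linorder} sqmat)) i = F i (pos b) - F i (pos b - 1)"
  using sum_pos_telescope[OF assms(2), of "\<lambda>m. F m (pos b) - F m (pos b - 1)"]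
  by (simp add: psum_def column_def of_csum_def assms(1) algebra_simps)

subsection \<open>Rounding corner sums\<close>

definition round_csum :: "'n::{finite,linorder} sqmat \<Rightarrow> real \<Rightarrow> nat \<Rightarrow> nat \<Rightarrow> real" where
  "round_csum X u i j = of_int \<lfloor>csum X i j + u\<rfloor>"

text \<open>Floor is monotone and commutes with adding 1, so a common shift \<open>u\<close> keeps
  steps within [0, 1].\<close>

lemma floor_diff_unit:
  fixes x d u :: real
  assumes "d \<in> {0..1}"
  shows "of_int \<lfloor>x + d + u\<rfloor> - of_int \<lfloor>x + u\<rfloor> \<in> {0..1::real}"
proof -
  have "\<lfloor>x + u\<rfloor> \<le> \<lfloor>x + d + u\<rfloor>" "\<lfloor>x + d + u\<rfloor> \<le> \<lfloor>x + u\<rfloor> + 1"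
    using assms by (auto intro!: floor_mono) linarith
  then show ?thesis by (simp flip: of_int_diff)
qed

lemma round_csum_HTSASM:
  fixes X :: "'n::{finite,linorder} sqmat"
  assumes X: "X \<in> P_ASM" "X \<in> P_HTS" and u: "0 \<le> u" "u < 1"
  shows "is_ASM (of_csum (round_csum X u) :: 'n::{finite,linorder} sqmat)"
    "of_csum (round_csum X u) \<in> (P_HTS :: 'n::{finite,linorder} sqmat set)"
proof -
  let ?F = "round_csum X u" and ?N = "CARD('n)"
  let ?Y = "of_csum ?F :: 'n sqmat"
  note unit = P_ASM_imp_unit_psums[OF X(1)]
  have r: "psum (row a X) ?N = 1" and c: "psum (column a X) ?N = 1" for a
    using unit by (auto simp: unit_psums_def)
  \<comment> \<open>As \<open>0 \<le> u < 1\<close>, rounding fixes the integer boundary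
    values.\<close>
  have nat: "\<lfloor>real m + u\<rfloor> = int m" for m using u by linarith
  have F0: "?F 0 j = 0" "?F i 0 = 0" for i j
    using nat[of 0] by (simp_all add: round_csum_def csum_0)
  have FN: "?F ?N m = real m" "?F m ?N = real m" if "m \<le> ?N" for m
    using that by (simp_all add: round_csum_def csum_card_left[OF c] csum_card_right[OF r] nat)
  have "unit_psums (row a ?Y)" for a
    unfolding unit_psums_def
  proof (intro conjI allI impI)
    fix j assume j: "j \<le> ?N"
    have "psum (row a X) j \<in> {0..1}" using unit j by (auto simp: unit_psums_def)
    from floor_diff_unit[OF this, of "csum X (pos a - 1) j" u]
    show "psum (row a ?Y) j \<in> {0..1}"
      unfolding psum_row_of_csum[where F = ?F, OF F0(2) j] by (simp add: round_csum_def csum_row)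
  next
    show "psum (row a ?Y) ?N = 1"
      using pos_ge_1[of a] pos_le_card[of a]
      by (simp add: psum_row_of_csum[where F = ?F, OF F0(2)] FN of_nat_diff)
  qed
  moreover have "unit_psums (column b ?Y)" for b
    unfolding unit_psums_def
  proof (intro conjI allI impI)
    fix i assume i: "i \<le> ?N"
    have "psum (column b X) i \<in> {0..1}" using unit i by (auto simp: unit_psums_def)
    from floor_diff_unit[OF this, of "csum X i (pos b - 1)" u]
    show "psum (column b ?Y) i \<in> {0..1}"
      unfolding psum_column_of_csum[where F = ?F, OF F0(1) i] by (simp add: round_csum_def csum_column)
  next
    show "psum (column b ?Y) ?N = 1"
      using pos_ge_1[of b] pos_le_card[of b]
      by (simp add: psum_column_of_csum[where F = ?F, OF F0(1)] FN of_nat_diff)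
  qed
  moreover have Yint: "?Y $ a $ b \<in> \<int>" for a b
    by (simp add: of_csum_def round_csum_def)
  then have "row a ?Y $ b \<in> \<int>" "column b ?Y $ a \<in> \<int>" for a b
    by (simp_all add: row_def column_def)
  ultimately have "row a ?Y $ b \<in> {0, 1, -1}" "alternating (row a ?Y)" "alternating (column b ?Y)" for a b
    using unit_psums_imp_alternating by blast+
  then show "is_ASM ?Y" by (simp add: is_ASM_def row_def)
  have opp: "?F (?N - i) (?N - j) = ?F i j + (real ?N - real i - real j)"
    if "i \<le> ?N" "j \<le> ?N" for i j
  proof -
    \<comment> \<open>The symmetry relates two corner sums by an integer offset, which passes
      through the floor.\<close>
    have "\<lfloor>csum X (?N - i) (?N - j) + u\<rfloor> = \<lfloor>(csum X i j + u) + of_int (int ?N - int i - int j)\<rfloor>"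
      using that by (intro arg_cong[of _ _ floor]) (simp add: csum_opp[OF X(2) r c])
    also have "\<dots> = \<lfloor>csum X i j + u\<rfloor> + (int ?N - int i - int j)"
      by (rule floor_add_int[symmetric])
    finally show ?thesis by (simp add: round_csum_def)
  qed
  have "?Y $ opp a $ opp b = ?Y $ a $ b" for a b
  proof -
    let ?i = "pos a" and ?j = "pos b"
    have i: "1 \<le> ?i" "?i \<le> ?N" and j: "1 \<le> ?j" "?j \<le> ?N"
      by (rule pos_ge_1 pos_le_card)+
    \<comment> \<open>In this form the half turn permutes the four corners of the mixed difference,
      and the affine offsets from \<open>opp\<close> cancel.\<close>
    have eq: "pos (opp a) = ?N - (?i - 1)" "?N - (?i - 1) - 1 = ?N - ?i"
      "pos (opp b) = ?N - (?j - 1)" "?N - (?j - 1) - 1 = ?N - ?j"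
      using i j by (auto simp: pos_opp)
    have le: "?i - 1 \<le> ?N" "?j - 1 \<le> ?N" using i j by auto
    show ?thesis
      by (simp only: of_csum_def vec_lambda_beta eq opp[OF i(2) j(2)] opp[OF le(1) j(2)]
        opp[OF i(2) le(2)] opp[OF le])
  qed
  then show "?Y \<in> P_HTS" by (simp add: P_HTS_def)
qed

section \<open>Averages of floors: Hermite's identity and the limit\<close>

text \<open>Raising \<open>m\<close> by 1 shifts the window of summation: the term
  \<open>m div N\<close> leaves and \<open>(m + N) div N\<close>, larger by 1, enters. At
  \<open>m = 0\<close> all terms vanish; induction runs in both directions.\<close>

lemma sum_div_shift:
  assumes "0 < N"
  shows "(\<Sum>k<N. (m + int k) div int N) = m"
proof -
  have step: "(\<Sum>k<N. (i + 1 + int k) div int N) = (\<Sum>k<N. (i + int k) div int N) + 1" for i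
  proof -
    have "(\<Sum>k<N. (i + 1 + int k) div int N) - (\<Sum>k<N. (i + int k) div int N) =
          (\<Sum>k<N. (i + int (Suc k)) div int N - (i + int k) div int N)"
      by (simp add: sum_subtractf algebra_simps)
    also have "\<dots> = (i + int N) div int N - (i + int 0) div int N"
      by (rule sum_lessThan_telescope)
    also have "\<dots> = 1" using assms by simp
    finally show ?thesis by simp
  qed
  show ?thesis
  proof (induction m rule: int_induct[where k = 0])
    case base
    show ?case by simp
  next
    case (step1 i)
    then show ?case using step[of i] by simp
  next
    case (step2 i)
    then show ?case using step[of "i - 1"] by simp
  qed
qed

text \<open>Each summand is \<open>\<lfloor>(N * x + k) / N\<rfloor>\<close>, hence the integer
  quotient of \<open>\<lfloor>N * x\<rfloor> + k\<close> by \<open>N\<close>.\<close>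

lemma Hermite_floor:
  fixes x :: real
  assumes "0 < N"
  shows "(\<Sum>k<N. \<lfloor>x + real k / real N\<rfloor>) = \<lfloor>real N * x\<rfloor>"
proof -
  have "\<lfloor>x + real k / real N\<rfloor> = (\<lfloor>real N * x\<rfloor> + int k) div int N" for k
  proof -
    have "\<lfloor>x + real k / real N\<rfloor> = \<lfloor>(real N * x + of_int (int k)) / of_int (int N)\<rfloor>"
      using assms by (intro arg_cong[of _ _ floor]) (simp add: field_simps)
    also have "\<dots> = \<lfloor>real N * x + of_int (int k)\<rfloor> div int N"
      by (rule floor_divide_real_eq_div) simp
    finally show ?thesis by simp
  qed
  then show ?thesis using sum_div_shift[OF assms] by simp
qed

lemma floor_mult_over_tendsto: "(\<lambda>N. of_int \<lfloor>real N * x\<rfloor> / real N) \<longlonglongrightarrow> (x :: real)"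
proof (rule tendsto_sandwich)
  show "\<forall>\<^sub>F N in sequentially. x - 1 / real N \<le> of_int \<lfloor>real N * x\<rfloor> / real N"
    using eventually_gt_at_top[of 0]
  proof eventually_elim
    case (elim N)
    have "real N * x - 1 \<le> of_int \<lfloor>real N * x\<rfloor>" by linarith
    then have "(real N * x - 1) / real N \<le> of_int \<lfloor>real N * x\<rfloor> / real N"
      by (rule divide_right_mono) simp
    then show ?case using elim by (simp add: diff_divide_distrib)
  qed
  show "\<forall>\<^sub>F N in sequentially. of_int \<lfloor>real N * x\<rfloor> / real N \<le> x"
    using eventually_gt_at_top[of 0]
  proof eventually_elim
    case (elim N)
    have "of_int \<lfloor>real N * x\<rfloor> \<le> real N * x" by linarith
    then show ?case using elim by (simp add: field_simps)
  qed
  show "(\<lambda>N. x - 1 / real N) \<longlonglongrightarrow> x"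
    using tendsto_diff[OF tendsto_const lim_1_over_n, of x] by simp
qed auto

section \<open>Closedness of the hull and the two inclusions\<close>

lemma finite_vec_entries:
  assumes "finite S"
  shows "finite {v :: 'a^'n. \<forall>i. v $ i \<in> S}"
proof (rule finite_imageD)
  have "vec_nth ` {v :: 'a^'n. \<forall>i. v $ i \<in> S} \<subseteq> (\<Pi>\<^sub>E i\<in>UNIV. S)" by auto
  then show "finite (vec_nth ` {v :: 'a^'n. \<forall>i. v $ i \<in> S})"
    by (rule finite_subset) (auto intro: finite_PiE assms)
  show "inj_on vec_nth {v :: 'a^'n. \<forall>i. v $ i \<in> S}"
    by (auto simp: inj_on_def vec_nth_inject)
qed

text \<open>Finiteness makes the hull of the symmetric ASMs compact, so limits stay inside
  it.\<close>

lemma finite_ASM: "finite {X :: 'n::{finite,linorder} sqmat. is_ASM X}"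
proof -
  let ?S = "{v :: (real, 'n) vec. \<forall>i. v $ i \<in> {0, 1, -1}}"
  have "finite {X :: 'n sqmat. \<forall>i. X $ i \<in> ?S}"
    by (intro finite_vec_entries) simp
  then show ?thesis by (rule finite_subset[rotated]) (auto simp: is_ASM_def)
qed

lemma P_ASM_Int_P_HTS_subset:
  "P_ASM \<inter> P_HTS \<subseteq> (P_HTSASM :: 'n::{finite,linorder} sqmat set)"
proof
  fix X :: "'n sqmat"
  assume "X \<in> P_ASM \<inter> P_HTS"
  then have X: "X \<in> P_ASM" "X \<in> P_HTS" by auto
  define Y :: "nat \<Rightarrow> nat \<Rightarrow> 'n sqmat"
    where "Y N k = of_csum (round_csum X (real k / real N))" for N k
  \<comment> \<open>By Hermite's identity, \<open>G N\<close> is the mean of the \<open>N\<close>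
    rounded corner sum arrays.\<close>
  define G where "G N i j = of_int \<lfloor>real N * csum X i j\<rfloor> / real N" for N i j
  have sum_round: "(\<Sum>k<N. round_csum X (real k / real N) i j) = real N * G N i j" if "0 < N" for N i j
    using that Hermite_floor[OF that, of "csum X i j"]
    by (simp add: round_csum_def G_def flip: of_int_sum)
  \<comment> \<open>\<open>of_csum\<close> is linear, so averaging commutes with it.\<close>
  have mean: "(\<Sum>k<N. (1 / real N) *\<^sub>R Y N k) = of_csum (G N)" if "0 < N" for N
    using that
    by (simp add: vec_eq_iff Y_def of_csum_def sum_subtractf sum_round
        flip: sum_divide_distrib) (simp add: field_simps)
  have "of_csum (G N) \<in> (P_HTSASM :: 'n sqmat set)" if "0 < N" for N
    unfolding mean[OF that, symmetric]
  proof (rule convex_sum)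
    show "convex (P_HTSASM :: 'n sqmat set)"
      unfolding P_HTSASM_def by (rule convex_convex_hull)
    fix k assume "k \<in> {..<N}"
    then have "0 \<le> real k / real N" "real k / real N < 1" by auto
    from round_csum_HTSASM[OF X this] show "Y N k \<in> P_HTSASM"
      unfolding P_HTSASM_def Y_def by (auto intro: hull_inc)
  qed (use that in auto)
  then have "\<forall>\<^sub>F N in sequentially. of_csum (G N) \<in> (P_HTSASM :: 'n sqmat set)"
    by (rule eventually_mono[OF eventually_gt_at_top[of 0]])
  moreover have "(\<lambda>N. of_csum (G N) :: 'n sqmat) \<longlonglongrightarrow> of_csum (csum X)"
    unfolding of_csum_def G_def by (intro tendsto_vec_lambda tendsto_diff floor_mult_over_tendsto)
  moreover have "closed (P_HTSASM :: 'n sqmat set)"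
    unfolding P_HTSASM_def using finite_ASM[where 'n = 'n]
    by (intro compact_imp_closed finite_imp_compact_convex_hull) (auto elim: rev_finite_subset)
  ultimately have "of_csum (csum X) \<in> (P_HTSASM :: 'n sqmat set)"
    by (intro Lim_in_closed_set[of _ _ sequentially]) auto
  then show "X \<in> P_HTSASM" by (simp add: of_csum_csum)
qed

theorem theorem5p3:
  "(P_HTSASM :: (real^'n::{finite,linorder}^'n::{finite,linorder}) set) = P_ASM \<inter> P_HTS"
proof
  \<comment> \<open>The easy inclusion: the symmetry conditions are linear, and hulls are
    monotone.\<close>
  have "convex (P_HTS :: 'n sqmat set)"
    by (auto simp: P_HTS_def convex_def)
  then have "P_HTSASM \<subseteq> (P_HTS :: 'n sqmat set)"
    unfolding P_HTSASM_def by (intro hull_minimal) auto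
  moreover have "P_HTSASM \<subseteq> (P_ASM :: 'n sqmat set)"
    unfolding P_HTSASM_def P_ASM_def by (intro hull_mono) auto
  ultimately show "P_HTSASM \<subseteq> (P_ASM \<inter> P_HTS :: 'n sqmat set)" by blast
qed (rule P_ASM_Int_P_HTS_subset)

end
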